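(* Let $D$ be the Dynkin diagram of the rank 4 hyperbolic Kac-Moody algebra with vertices $1,2,3,4$ and single edges $1-2$, $1-4$, $2-3$, $3-4$, $2-4$ (every pair of vertices except $\{1,3\}$ is joined by a single edge). The equivalence classes of nonempty paintings of $D$ are given by (a) $(3)\sim(1)$; (b) $(4)\sim(2)$; (c) $(2,4)$. That is, the paintings within one item are equivalent, paintings in different items are inequivalent, and every nonempty painting is equivalent to one of those listed.
   Context: A painting of a Dynkin diagram is a choice of a subset of its vertices, called painted (a Vogan diagram with trivial diagram involution). The painting whose painted vertices are exactly $i_1,\dots,i_k$ is denoted $(i_1,\dots,i_k)$. For a painted vertex $i$, the operation $F\langle i\rangle$ (reflection in the noncompact simple root $i$) keeps the color of $i$ and of all vertices not adjacent to $i$ and, the diagram being simply laced, reverses the colors of all vertices adjacent to $i$. Equivalence $\sim$ of paintings is the equivalence relation generated by all operations $F\langle i\rangle$ ($i$ painted) and by automorphisms of the Dynkin diagram. *)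

theory Defs
  imports Main
begin

text \<open>A simply laced Dynkin diagram is a simple graph, given by its vertex set \<open>V\<close> and its set \<open>E\<close>
  of edges, which are two-element subsets of \<open>V\<close>. A painting is the set of its painted vertices.\<close>

definition is_painting :: "'a set \<Rightarrow> 'a set \<Rightarrow> bool" where
  "is_painting V P \<longleftrightarrow> P \<subseteq> V"

definition neighbours :: "'a set \<Rightarrow> 'a set set \<Rightarrow> 'a \<Rightarrow> 'a set" where
  "neighbours V E i = {v \<in> V. {i, v} \<in> E}"

text \<open>The operation \<open>F\<langle>i\<rangle>\<close>: symmetric difference with the set of neighbours of \<open>i\<close>. The vertex
  \<open>i\<close> keeps its colour because \<open>{i, i}\<close> is not a two-element set.\<close>

definition F_op :: "'a set \<Rightarrow> 'a set set \<Rightarrow> 'a \<Rightarrow> 'a set \<Rightarrow> 'a set" where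
  "F_op V E i P = (P - neighbours V E i) \<union> (neighbours V E i - P)"

definition diagram_automorphism :: "'a set \<Rightarrow> 'a set set \<Rightarrow> ('a \<Rightarrow> 'a) \<Rightarrow> bool" where
  "diagram_automorphism V E f \<longleftrightarrow>
     bij_betw f V V \<and> (\<forall>u\<in>V. \<forall>v\<in>V. {f u, f v} \<in> E \<longleftrightarrow> {u, v} \<in> E)"

inductive painting_step :: "'a set \<Rightarrow> 'a set set \<Rightarrow> 'a set \<Rightarrow> 'a set \<Rightarrow> bool"
  for V :: "'a set" and E :: "'a set set" where
  reflection: "is_painting V P \<Longrightarrow> i \<in> P \<Longrightarrow> painting_step V E P (F_op V E i P)"
| automorphism: "is_painting V P \<Longrightarrow> diagram_automorphism V E f \<Longrightarrow> painting_step V E P (f ` P)"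

definition painting_equiv :: "'a set \<Rightarrow> 'a set set \<Rightarrow> 'a set \<Rightarrow> 'a set \<Rightarrow> bool" where
  "painting_equiv V E = equivclp (painting_step V E)"

definition D_vertices :: "nat set" where
  "D_vertices = {1, 2, 3, 4}"

definition D_edges :: "nat set set" where
  "D_edges = {{1, 2}, {1, 4}, {2, 3}, {3, 4}, {2, 4}}"

abbreviation D_equiv :: "nat set \<Rightarrow> nat set \<Rightarrow> bool" where
  "D_equiv \<equiv> painting_equiv D_vertices D_edges"

end

theory Submission
  imports Defs
begin

text \<open>Modulo 2, the radical of the symmetric Cartan matrix is spanned by \<open>\<alpha>\<^sub>1 + \<alpha>\<^sub>3\<close> and
  \<open>\<alpha>\<^sub>1 + \<alpha>\<^sub>2 + \<alpha>\<^sub>4\<close>, so no \<open>F\<langle>i\<rangle>\<close> changes the parity of the number of painted vertices in \<open>{1, 3}\<close>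
  or in \<open>{1, 2, 4}\<close>. A diagram automorphism stabilises both \<open>{1, 3}\<close> and \<open>{2, 4}\<close>; it preserves the
  first parity, and also the second one as long as \<open>1\<close> and \<open>3\<close> have the same colour. These
  invariants separate the three items, and short chains of reflections, together with the swap of
  \<open>1\<close> and \<open>3\<close>, reach every nonempty painting.\<close>

definition ends_agree :: "nat set \<Rightarrow> bool" where
  "ends_agree P \<longleftrightarrow> (1 \<in> P \<longleftrightarrow> 3 \<in> P)"

text \<open>The nested \<open>\<longleftrightarrow>\<close> holds exactly when an odd number of its
  three parts do. The conjunct \<open>ends_agree P\<close> secures invariance under an exchange of 1
  and 3.\<close>

definition triangle_odd :: "nat set \<Rightarrow> bool" where
  "triangle_odd P \<longleftrightarrow> ends_agree P \<and> (1 \<in> P \<longleftrightarrow> (2 \<in> P \<longleftrightarrow> 4 \<in> P))"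

lemma D_neighbours:
  "neighbours D_vertices D_edges 1 = {2, 4}"
  "neighbours D_vertices D_edges 2 = {1, 3, 4}"
  "neighbours D_vertices D_edges 3 = {2, 4}"
  "neighbours D_vertices D_edges 4 = {1, 2, 3}"
  by (auto simp: neighbours_def D_vertices_def D_edges_def doubleton_eq_iff)

lemma D_edge_iff:
  assumes "u \<in> {1, 2, 3, 4}" "v \<in> {1, 2, 3, 4}"
  shows "{u, v} \<in> D_edges \<longleftrightarrow> u \<noteq> v \<and> \<not> (u = 1 \<and> v = 3) \<and> \<not> (u = 3 \<and> v = 1)"
  using assms unfolding D_edges_def by (elim insertE emptyE) (simp_all add: doubleton_eq_iff)

text \<open>The only two distinct vertices not joined by an edge are 1 and 3, so they can only be
  fixed or exchanged.\<close>

lemma D_automorphism_cases: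
  assumes "diagram_automorphism D_vertices D_edges f"
  shows "(f 1 = 1 \<and> f 3 = 3 \<or> f 1 = 3 \<and> f 3 = 1) \<and> (f 2 = 2 \<and> f 4 = 4 \<or> f 2 = 4 \<and> f 4 = 2)"
proof -
  have bij: "bij_betw f D_vertices D_vertices"
    and edges: "\<And>u v. u \<in> D_vertices \<Longrightarrow> v \<in> D_vertices \<Longrightarrow> {f u, f v} \<in> D_edges \<longleftrightarrow> {u, v} \<in> D_edges"
    using assms by (auto simp: diagram_automorphism_def)
  have range: "f i \<in> {1, 2, 3, 4}" if "i \<in> {1, 2, 3, 4}" for i
    using bij that by (metis bij_betwE D_vertices_def)
  have inj: "f 1 \<noteq> f 2" "f 1 \<noteq> f 3" "f 1 \<noteq> f 4" "f 2 \<noteq> f 3" "f 2 \<noteq> f 4" "f 3 \<noteq> f 4"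
    using bij by (auto simp: bij_betw_def inj_on_def D_vertices_def)
  have "{f 1, f 3} \<notin> D_edges"
    using edges[of 1 3] by (simp add: D_vertices_def D_edge_iff)
  then have "f 1 = 1 \<and> f 3 = 3 \<or> f 1 = 3 \<and> f 3 = 1"
    using range[of 1] range[of 3] inj(2) D_edge_iff[of "f 1" "f 3"] by auto
  then show ?thesis
    using range[of 2] range[of 4] inj by auto
qed

text \<open>Every neighbour set meets both {1, 3} and {1, 2, 4} in an even number of vertices, so a
  reflection changes neither parity.\<close>

lemma painting_step_invariants:
  assumes "painting_step D_vertices D_edges P Q"
  shows "ends_agree P = ends_agree Q \<and> triangle_odd P = triangle_odd Q"
  using assms
proof cases
  case (reflection i)
  then consider "i = 1" | "i = 2" | "i = 3" | "i = 4"
    by (auto simp: is_painting_def D_vertices_def)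
  then show ?thesis
    using reflection
    by cases (auto simp: F_op_def D_neighbours[simplified] ends_agree_def triangle_odd_def)
next
  case (automorphism f)
  have mem: "j \<in> f ` P \<longleftrightarrow> j = f 1 \<and> 1 \<in> P \<or> j = f 2 \<and> 2 \<in> P \<or> j = f 3 \<and> 3 \<in> P \<or> j = f 4 \<and> 4 \<in> P"
    for j
    using automorphism by (auto simp: is_painting_def D_vertices_def)
  show ?thesis
    using D_automorphism_cases[OF automorphism(3)]
    by (elim conjE disjE) (auto simp: ends_agree_def triangle_odd_def automorphism(1) mem)
qed

lemma D_equiv_invariants:
  assumes "D_equiv P Q"
  shows "ends_agree P = ends_agree Q \<and> triangle_odd P = triangle_odd Q"
  using assms unfolding painting_equiv_def
  by (induction rule: equivclp_induct) (auto dest: painting_step_invariants)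

lemma D_equiv_sym: "D_equiv P Q \<Longrightarrow> D_equiv Q P"
  unfolding painting_equiv_def by (rule equivclp_sym)

lemma D_equiv_trans [trans]: "D_equiv P Q \<Longrightarrow> D_equiv Q R \<Longrightarrow> D_equiv P R"
  unfolding painting_equiv_def by (rule equivclp_trans)

lemma D_equiv_refl: "D_equiv P P"
  unfolding painting_equiv_def by (rule equivclp_refl)

lemma D_equiv_reflection:
  assumes "P \<subseteq> {1, 2, 3, 4}" "i \<in> P" "F_op D_vertices D_edges i P = Q"
  shows "D_equiv P Q"
  using painting_step.reflection[of D_vertices P i D_edges] assms
  unfolding painting_equiv_def by (auto simp: is_painting_def D_vertices_def)

text \<open>The links form the chains {3,4}, {2,3}, {1,2,4}, {1} and {1,4}, {1,2}, {2,3,4}, {3}; the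
  paths from {4} and from {1,3} through {1,2,3,4} to {2}; and two single steps to {2,4}.\<close>

lemma D_equiv_reflections:
  "D_equiv {2, 3, 4} {3}"
  "D_equiv {1, 2} {2, 3, 4}"
  "D_equiv {1, 4} {1, 2}"
  "D_equiv {1, 2, 4} {1}"
  "D_equiv {2, 3} {1, 2, 4}"
  "D_equiv {3, 4} {2, 3}"
  "D_equiv {1, 2, 3, 4} {2}"
  "D_equiv {4} {1, 2, 3, 4}"
  "D_equiv {1, 3} {1, 2, 3, 4}"
  "D_equiv {1, 2, 3} {2, 4}"
  "D_equiv {1, 3, 4} {2, 4}"
  subgoal by (rule D_equiv_reflection[of _ 3]) (auto simp: F_op_def D_neighbours[simplified])
  subgoal by (rule D_equiv_reflection[of _ 2]) (auto simp: F_op_def D_neighbours[simplified])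
  subgoal by (rule D_equiv_reflection[of _ 1]) (auto simp: F_op_def D_neighbours[simplified])
  subgoal by (rule D_equiv_reflection[of _ 1]) (auto simp: F_op_def D_neighbours[simplified])
  subgoal by (rule D_equiv_reflection[of _ 2]) (auto simp: F_op_def D_neighbours[simplified])
  subgoal by (rule D_equiv_reflection[of _ 3]) (auto simp: F_op_def D_neighbours[simplified])
  subgoal by (rule D_equiv_reflection[of _ 2]) (auto simp: F_op_def D_neighbours[simplified])
  subgoal by (rule D_equiv_reflection[of _ 4]) (auto simp: F_op_def D_neighbours[simplified])
  subgoal by (rule D_equiv_reflection[of _ 1]) (auto simp: F_op_def D_neighbours[simplified])
  subgoal by (rule D_equiv_reflection[of _ 2]) (auto simp: F_op_def D_neighbours[simplified])
  subgoal by (rule D_equiv_reflection[of _ 4]) (auto simp: F_op_def D_neighbours[simplified])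
  done

text \<open>Reflections alone cannot link these two: {1} has an odd and {3} an even number of
  painted vertices in {1, 2, 4}.\<close>

lemma D_equiv_3_1: "D_equiv {3} {1}"
proof -
  define f :: "nat \<Rightarrow> nat" where "f = id(1 := 3, 3 := 1)"
  have "diagram_automorphism D_vertices D_edges f"
    unfolding diagram_automorphism_def bij_betw_def inj_on_def f_def D_vertices_def D_edges_def
    by (simp add: doubleton_eq_iff insert_commute)
  then have "painting_step D_vertices D_edges {3} (f ` {3})"
    by (intro painting_step.automorphism) (auto simp: is_painting_def D_vertices_def)
  then show ?thesis
    unfolding painting_equiv_def by (auto simp: f_def)
qed

lemma D_equiv_representative:
  assumes "P \<subseteq> {1, 2, 3, 4}" "P \<noteq> {}"
  shows "D_equiv P {1} \<or> D_equiv P {2} \<or> D_equiv P {2, 4}"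
proof -
  note s = D_equiv_reflections and tr = D_equiv_trans
  have 3: "D_equiv {3} {1}" by (rule D_equiv_3_1)
  have 234: "D_equiv {2, 3, 4} {1}" by (rule tr[OF s(1) 3])
  have 12: "D_equiv {1, 2} {1}" by (rule tr[OF s(2) 234])
  have 14: "D_equiv {1, 4} {1}" by (rule tr[OF s(3) 12])
  have 23: "D_equiv {2, 3} {1}" by (rule tr[OF s(5) s(4)])
  have 34: "D_equiv {3, 4} {1}" by (rule tr[OF s(6) 23])
  have 4: "D_equiv {4} {2}" by (rule tr[OF s(8) s(7)])
  have 13: "D_equiv {1, 3} {2}" by (rule tr[OF s(9) s(7)])
  from assms(1) have "P \<in> Pow {1, 2, 3, 4}"
    by (rule PowI)
  then show ?thesis
    \<comment> \<open>Of the fifteen nonempty paintings, eight go to {1}, four to {2} and three to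
      {2, 4}.\<close>
    using 3 234 12 14 23 34 4 13 s(4,7,10,11) D_equiv_refl assms(2)
    by (simp only: Pow_insert Pow_empty image_insert image_empty image_Un Un_insert_left
        Un_empty_left insert_iff empty_iff) blast
qed

theorem proposition5p11:
  fixes items :: "nat set set set"
  defines "items \<equiv> {{{3}, {1}}, {{4}, {2}}, {{2, 4}}}"
  shows "(\<forall>A\<in>items. \<forall>P\<in>A. \<forall>Q\<in>A. D_equiv P Q) \<and>
    (\<forall>A\<in>items. \<forall>B\<in>items. A \<noteq> B \<longrightarrow> (\<forall>P\<in>A. \<forall>Q\<in>B. \<not> D_equiv P Q)) \<and>
    (\<forall>P. is_painting D_vertices P \<and> P \<noteq> {} \<longrightarrow> (\<exists>A\<in>items. \<exists>Q\<in>A. D_equiv P Q))"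
proof (intro conjI)
  have 42: "D_equiv {4} {2}"
    by (rule D_equiv_trans[OF D_equiv_reflections(8) D_equiv_reflections(7)])
  show "\<forall>A\<in>items. \<forall>P\<in>A. \<forall>Q\<in>A. D_equiv P Q"
    using D_equiv_3_1 42 D_equiv_sym[OF D_equiv_3_1] D_equiv_sym[OF 42] D_equiv_refl
    by (simp add: items_def)
  show "\<forall>A\<in>items. \<forall>B\<in>items. A \<noteq> B \<longrightarrow> (\<forall>P\<in>A. \<forall>Q\<in>B. \<not> D_equiv P Q)"
    unfolding items_def
    \<comment> \<open>The pair (\<open>ends_agree\<close>, \<open>triangle_odd\<close>) is (False,
      False) on the first item, (True, True) on the second and (True, False) on the third.\<close>
    by (auto dest!: D_equiv_invariants simp: ends_agree_def triangle_odd_def)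
  show "\<forall>P. is_painting D_vertices P \<and> P \<noteq> {} \<longrightarrow> (\<exists>A\<in>items. \<exists>Q\<in>A. D_equiv P Q)"
    using D_equiv_representative by (auto simp: is_painting_def D_vertices_def items_def)
qed

end
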